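(* For any integers $k \geq 0$ and $n \geq 1$, $$S_{k}(n) = \frac{(-1)^{k+1}}{k+1} \sum_{j=1}^{k+1} (-1)^{j}\, j!\, \left\{ {k+1 \atop j} \right\} \left( H_{j+1}^{(n)} - \frac{1}{j+1} \right),$$ where $S_k(n) = 1^k + 2^k + \cdots + n^k$, $\left\{ {k+1 \atop j} \right\}$ is a Stirling number of the second kind, and $H_{j+1}^{(n)}$ is the $(j+1)$-th hyperharmonic number of order $n$.
   Context: The hyperharmonic numbers $H_n^{(r)}$ (the $n$-th hyperharmonic number of order $r$) are defined recursively by $H_n^{(0)} = \frac{1}{n}$ for $n \geq 1$, $H_n^{(1)} = H_n = 1 + \frac12 + \cdots + \frac1n$ (the ordinary harmonic number), and $H_n^{(r)} = \sum_{k=1}^{n} H_k^{(r-1)}$, with $H_0^{(r)} = 0$ for $r \geq 0$. The Stirling number of the second kind $\left\{ {k \atop j} \right\}$ is the number of partitions of a $k$-element set into $j$ nonempty blocks. *)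

theory Defs
  imports Complex_Main "HOL-Combinatorics.Stirling"
begin

text \<open>
  \<open>hyperharmonic r n\<close> is the \<open>n\<close>-th hyperharmonic number of order \<open>r\<close>, written \<open>H\<^sub>n\<^sup>(\<^sup>r\<^sup>)\<close>.
  The recursion starts at order 0; order 1 then gives the ordinary harmonic numbers
  (lemma \<open>hyperharmonic_1\<close>).
\<close>

primrec hyperharmonic :: "nat \<Rightarrow> nat \<Rightarrow> real" where
  "hyperharmonic 0 n = (if n = 0 then 0 else 1 / real n)"
| "hyperharmonic (Suc r) n = (\<Sum>k = 1..n. hyperharmonic r k)"

lemma hyperharmonic_at_0: "hyperharmonic r 0 = 0"
  by (cases r) simp_all

lemma hyperharmonic_1: "hyperharmonic 1 n = (\<Sum>k = 1..n. 1 / real k)"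
  by simp

definition power_sum :: "nat \<Rightarrow> nat \<Rightarrow> real" where
  "power_sum k n = (\<Sum>i = 1..n. real i ^ k)"

end

theory Submission
  imports Defs
begin

text \<open>
  For a sequence \<open>a\<close> consider the alternating sums \<open>L\<^sub>m(a) = \<Sum>j\<le>m. (-1)\<^sup>j j! S(m,j) a\<^sub>j\<close>.
  The recurrence of the Stirling numbers says \<open>L\<^bsub>m+1\<^esub>(a) = L\<^sub>m(D a)\<close>, where \<open>(D a)\<^sub>j = j a\<^sub>j - (j+1) a\<^bsub>j+1\<^esub>\<close>
  (lemma \<open>alternating_Stirling_sum_Suc\<close>). In terms of generating functions, \<open>D\<close> is
  \<open>f \<mapsto> -(1-x) f'\<close>. Since \<open>L\<^sub>0(a) = a\<^sub>0\<close>, it follows that \<open>L\<^sub>m(a) = (D\<^sup>m a)\<^sub>0\<close>.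

  Fix \<open>r\<close>. The hyperharmonic numbers of order \<open>r\<close> have the generating
  function \<open>-ln (1-x) / (1-x)\<^sup>r\<close>, and the multiset coefficients \<open>C(r+j-1, j)\<close> have \<open>1 / (1-x)\<^sup>r\<close>.
  On the span of these two sequences \<open>D\<close> is a Jordan block with eigenvalue \<open>-r\<close>, and
  \<open>m \<ge> 1\<close> applications of it produce
  \<open>\<Sum>j\<le>m. (-1)\<^sup>j j! S(m,j) H\<^sub>j\<^sup>(\<^sup>r\<^sup>) = (-1)\<^sup>m m r\<^bsup>m-1\<^esup>\<close>
  (lemma \<open>alternating_Stirling_sum_hyperharmonic\<close>).

  With \<open>m = k+1\<close> the right-hand side is \<open>(-1)\<^bsup>k+1\<^esup> (k+1)\<close> times the last summand \<open>r\<^sup>k\<close> of the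
  power sum. The theorem follows by telescoping over the order, because
  \<open>H\<^bsub>j+1\<^esub>\<^sup>(\<^sup>r\<^sup>) - H\<^bsub>j+1\<^esub>\<^sup>(\<^sup>r\<^sup>-\<^sup>1\<^sup>) = H\<^sub>j\<^sup>(\<^sup>r\<^sup>)\<close>, and the subtracted \<open>1/(j+1)\<close> is the order-0 term at which
  the telescoping starts.
\<close>

definition alternating_Stirling_sum :: "nat \<Rightarrow> (nat \<Rightarrow> real) \<Rightarrow> real" where
  "alternating_Stirling_sum m a = (\<Sum>j\<le>m. (-1) ^ j * fact j * real (Stirling m j) * a j)"

lemma alternating_Stirling_sum_0: "alternating_Stirling_sum 0 a = a 0"
  by (simp add: alternating_Stirling_sum_def)

lemma alternating_Stirling_sum_linear:
  "alternating_Stirling_sum m (\<lambda>j. c * a j + d * b j) =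
    c * alternating_Stirling_sum m a + d * alternating_Stirling_sum m b"
  by (simp add: alternating_Stirling_sum_def sum_distrib_left sum.distrib algebra_simps)

text \<open>
  In \<open>S(m+1,j) = j S(m,j) + S(m,j-1)\<close> the first term multiplies \<open>a\<^sub>j\<close> by \<open>j\<close>; in the second one,
  shifting the index turns \<open>j!\<close> into \<open>(j+1) j!\<close> and flips the sign.
\<close>

lemma alternating_Stirling_sum_Suc:
  "alternating_Stirling_sum (Suc m) a =
    alternating_Stirling_sum m (\<lambda>j. real j * a j - real (Suc j) * a (Suc j))"
proof -
  define w where "w j = (-1) ^ j * fact j * real (Stirling m j)" for j :: nat
  have "alternating_Stirling_sum (Suc m) a =
      (\<Sum>j\<le>m. (-1) ^ Suc j * fact (Suc j) * real (Stirling (Suc m) (Suc j)) * a (Suc j))"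
    unfolding alternating_Stirling_sum_def by (subst sum.atMost_Suc_shift) simp
  also have "\<dots> = (\<Sum>j\<le>m. w (Suc j) * (real (Suc j) * a (Suc j)) - w j * (real (Suc j) * a (Suc j)))"
    by (rule sum.cong) (simp_all add: w_def algebra_simps)
  also have "\<dots> = (\<Sum>j\<le>m. w (Suc j) * (real (Suc j) * a (Suc j))) -
      (\<Sum>j\<le>m. w j * (real (Suc j) * a (Suc j)))"
    by (rule sum_subtractf)
  also have "(\<Sum>j\<le>m. w (Suc j) * (real (Suc j) * a (Suc j))) = (\<Sum>j\<le>Suc m. w j * (real j * a j))"
    by (subst sum.atMost_Suc_shift) simp
  \<comment> \<open>The top term vanishes because \<open>S(m, m+1) = 0\<close>.\<close>
  also have "\<dots> = (\<Sum>j\<le>m. w j * (real j * a j))"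
    by (simp add: w_def)
  finally show ?thesis
    by (simp add: alternating_Stirling_sum_def w_def sum_subtractf[symmetric] right_diff_distrib)
qed

text \<open>
  The coefficients of \<open>1 / (1-x)\<^sup>r\<close>, that is \<open>C(r+j-1, j)\<close>, in a form that is also correct
  for \<open>r = 0\<close>.
\<close>

definition multiset_coeff :: "nat \<Rightarrow> nat \<Rightarrow> real" where
  "multiset_coeff r j = pochhammer (real r) j / fact j"

lemma multiset_coeff_right_0: "multiset_coeff r 0 = 1"
  by (simp add: multiset_coeff_def)

lemma multiset_coeff_left_0: "multiset_coeff 0 j = (if j = 0 then 1 else 0)"
  by (simp add: multiset_coeff_def pochhammer_0_left)

lemma Suc_times_multiset_coeff:
  "real (Suc j) * multiset_coeff r (Suc j) = (real r + real j) * multiset_coeff r j"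
  by (simp add: multiset_coeff_def pochhammer_Suc field_simps del: of_nat_Suc)

lemma multiset_coeff_Pascal:
  "multiset_coeff (Suc r) (Suc j) = multiset_coeff (Suc r) j + multiset_coeff r (Suc j)"
proof -
  have "real (Suc j) * multiset_coeff r (Suc j) = real r * multiset_coeff (Suc r) j"
    by (simp add: multiset_coeff_def pochhammer_rec add.commute del: of_nat_Suc)
      (simp add: add.commute)
  then have "real (Suc j) * multiset_coeff (Suc r) (Suc j) =
      real (Suc j) * (multiset_coeff (Suc r) j + multiset_coeff r (Suc j))"
    unfolding Suc_times_multiset_coeff distrib_left by (simp add: algebra_simps)
  then show ?thesis
    by (simp del: of_nat_Suc)
qed

lemma hyperharmonic_Suc_Suc:
  "hyperharmonic (Suc r) (Suc j) = hyperharmonic (Suc r) j + hyperharmonic r (Suc j)"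
  by simp

lemma hyperharmonic_Suc_0: "hyperharmonic r (Suc 0) = 1"
  by (induction r) simp_all

text \<open>
  Comparison of coefficients in \<open>(1-x) G' = r G + 1 / (1-x)\<^sup>r\<close> for \<open>G = -ln (1-x) / (1-x)\<^sup>r\<close>.
  The induction replaces the differential equation by the Pascal-type recurrence that both
  sequences satisfy.
\<close>

lemma hyperharmonic_recurrence:
  "real (Suc j) * hyperharmonic r (Suc j) - real j * hyperharmonic r j =
    real r * hyperharmonic r j + multiset_coeff r j"
proof (induction r arbitrary: j)
  case 0
  then show ?case
    by (simp add: multiset_coeff_left_0)
next
  case (Suc r)
  note order_IH = Suc.IH
  show ?case
  proof (induction j)
    case 0
    then show ?case
      by (simp only: hyperharmonic_Suc_0 hyperharmonic_at_0 multiset_coeff_right_0)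
  next
    case (Suc j)
    define H where "H = hyperharmonic (Suc r)"
    define G where "G = hyperharmonic r"
    have step: "H (Suc i) = H i + G (Suc i)" for i
      unfolding H_def G_def by (rule hyperharmonic_Suc_Suc)
    have H: "real (Suc j) * H (Suc j) - real j * H j =
        real (Suc r) * H j + multiset_coeff (Suc r) j"
      using Suc.IH by (simp only: H_def)
    have G: "real (Suc (Suc j)) * G (Suc (Suc j)) - real (Suc j) * G (Suc j) =
        real r * G (Suc j) + multiset_coeff r (Suc j)"
      using order_IH[of "Suc j"] by (simp only: G_def)
    have "real (Suc (Suc j)) * H (Suc (Suc j)) - real (Suc j) * H (Suc j) =
        (real (Suc j) * H (Suc j) - real j * H j) +
        (real (Suc (Suc j)) * G (Suc (Suc j)) - real (Suc j) * G (Suc j)) + G (Suc j)"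
      by (simp add: step algebra_simps)
    also have "\<dots> = real (Suc r) * H (Suc j) + multiset_coeff (Suc r) (Suc j)"
      unfolding H G by (simp add: step multiset_coeff_Pascal algebra_simps)
    finally show ?case
      by (simp only: H_def)
  qed
qed

text \<open>
  The multiset coefficients are the eigenvector: \<open>D\<close> multiplies them by \<open>-r\<close>.
\<close>

lemma alternating_Stirling_sum_multiset_coeff:
  "alternating_Stirling_sum m (multiset_coeff r) = (- real r) ^ m"
proof (induction m)
  case 0
  then show ?case
    by (simp add: alternating_Stirling_sum_0 multiset_coeff_right_0)
next
  case (Suc m)
  have "real j * multiset_coeff r j - real (Suc j) * multiset_coeff r (Suc j) =
      - real r * multiset_coeff r j + 0 * multiset_coeff r j" for j
    unfolding Suc_times_multiset_coeff by (simp add: algebra_simps)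
  then show ?case
    by (simp only: alternating_Stirling_sum_Suc alternating_Stirling_sum_linear Suc.IH) simp
qed

text \<open>
  The hyperharmonic numbers are the generalised eigenvector, \<open>D H = -r H - C\<close>, so each
  application of \<open>D\<close> contributes one more copy of the value for the eigenvector.
\<close>

lemma alternating_Stirling_sum_hyperharmonic:
  "alternating_Stirling_sum (Suc k) (hyperharmonic r) =
    (-1) ^ Suc k * real (Suc k) * real r ^ k"
proof -
  have D: "real j * hyperharmonic r j - real (Suc j) * hyperharmonic r (Suc j) =
      - real r * hyperharmonic r j + (-1) * multiset_coeff r j" for j
    using hyperharmonic_recurrence[of j r] by linarith
  have rec: "alternating_Stirling_sum (Suc m) (hyperharmonic r) =
      - real r * alternating_Stirling_sum m (hyperharmonic r) - (- real r) ^ m" for m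
    unfolding alternating_Stirling_sum_Suc D alternating_Stirling_sum_linear
      alternating_Stirling_sum_multiset_coeff by simp
  show ?thesis
  proof (induction k)
    case 0
    then show ?case
      by (simp add: rec alternating_Stirling_sum_0 hyperharmonic_at_0)
  next
    case (Suc k)
    show ?case
      unfolding rec[of "Suc k"] Suc.IH power_minus[of "real r"] by (simp add: algebra_simps)
  qed
qed

theorem theorem1:
  fixes k n :: nat
  assumes "n \<ge> 1"
  shows "power_sum k n =
    (-1) ^ (k + 1) / real (k + 1) *
      (\<Sum>j = 1..k + 1. (-1) ^ j * fact j * real (Stirling (k + 1) j) *
        (hyperharmonic n (j + 1) - 1 / real (j + 1)))"
proof -
  define T where "T r = (\<Sum>j = 1..k + 1. (-1) ^ j * fact j * real (Stirling (k + 1) j) *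
      (hyperharmonic r (j + 1) - 1 / real (j + 1)))" for r
  have T_0: "T 0 = 0"
    by (simp add: T_def)
  have T_Suc: "T (Suc r) = T r + (-1) ^ (k + 1) * real (k + 1) * real (Suc r) ^ k" for r
  proof -
    have "T (Suc r) - T r =
        (\<Sum>j = 1..k + 1. (-1) ^ j * fact j * real (Stirling (k + 1) j) * hyperharmonic (Suc r) j)"
      unfolding T_def sum_subtractf[symmetric] Suc_eq_plus1[symmetric] hyperharmonic_Suc_Suc
      by (rule sum.cong) (simp_all only: algebra_simps)
    also have "\<dots> = alternating_Stirling_sum (Suc k) (hyperharmonic (Suc r))"
      unfolding alternating_Stirling_sum_def
      by (rule sum.mono_neutral_cong_left) (auto simp: not_le)
    finally show ?thesis
      by (simp add: alternating_Stirling_sum_hyperharmonic del: hyperharmonic.simps)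
  qed
  have "T n = (-1) ^ (k + 1) * real (k + 1) * power_sum k n"
  proof (induction n)
    case 0
    then show ?case
      by (simp add: T_0 power_sum_def)
  next
    case (Suc n)
    have "power_sum k (Suc n) = power_sum k n + real (Suc n) ^ k"
      by (simp add: power_sum_def)
    then show ?case
      by (simp only: T_Suc Suc.IH distrib_left)
  qed
  then have "(-1) ^ (k + 1) / real (k + 1) * T n =
      ((-1) ^ (k + 1) * (-1) ^ (k + 1)) * power_sum k n"
    by simp
  then show ?thesis
    unfolding T_def[symmetric] by (simp flip: power_mult_distrib)
qed

end
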